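(* Let $k$ be a positive odd integer such that every prime divisor $p$ of $k$ satisfies $p\equiv 1\pmod 4$, and let $u,t\in\mathbb{Z}$. Let $a_{ij}$ be integers satisfying $a_{11}=a_{21}=a_{31}$, $a_{12}=a_{22}$, $a_{13}=a_{23}=a_{33}$, and consider the system of linear equations $$\begin{pmatrix} a_{11}&-a_{12}&a_{13}&-a_{14}\\ a_{21}&-a_{22}&a_{23}&0\\ -3a_{31}&0&a_{33}&0\end{pmatrix}\begin{pmatrix}c_1\\c_2\\c_3\\c_4\end{pmatrix}=\begin{pmatrix}k^2\\4u-1\\4t-1\end{pmatrix}.$$ Let $s_1,\dots,s_N\in\mathbb{Z}^4$ be integer solutions of this system. For each $i$, writing $s_i=(c_1,c_2,c_3,c_4)$, consider the curve $$E_{s_i}: Y^2=a_{11}c_1X^3+a_{12}c_2X^2+a_{13}c_3X+a_{14}c_4.$$ Then for every $i=1,\dots,N$, the curve $E_{s_i}$ has no point $(x,y)$ with integer coordinates $x>1$, $y\ge 1$.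
   Context: The curves are the affine curves given by the displayed equation; no nonsingularity is required. The condition on prime divisors is vacuous for $k=1$. *)

theory Defs
  imports "HOL-Analysis.Analysis" "HOL-Number_Theory.Cong"
begin

definition coeff_matrix :: "int^4^3 \<Rightarrow> int^4^3" where
  "coeff_matrix a = vector [
     vector [a $ 1 $ 1, - (a $ 1 $ 2), a $ 1 $ 3, - (a $ 1 $ 4)],
     vector [a $ 2 $ 1, - (a $ 2 $ 2), a $ 2 $ 3, 0],
     vector [- 3 * (a $ 3 $ 1), 0, a $ 3 $ 3, 0]]"

text \<open>
  The points of the affine curve with coordinates in a commutative ring, viewed as an algebra
  over the integers. In particular, its integer points are obtained by taking the ring to be
  \<^typ>\<open>int\<close>.
\<close>

definition curve_points :: "int^4^3 \<Rightarrow> int^4 \<Rightarrow> ('r::comm_ring_1 \<times> 'r) set" where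
  "curve_points a c = {(X, Y).
     Y^2 = of_int (a $ 1 $ 1 * c $ 1) * X^3 + of_int (a $ 1 $ 2 * c $ 2) * X^2
         + of_int (a $ 1 $ 3 * c $ 3) * X + of_int (a $ 1 $ 4 * c $ 4)}"

end

theory Submission
  imports Defs "HOL-Number_Theory.Residues"
begin

text \<open>
  Write \<open>f\<close> for the cubic on the right-hand side of the curve and \<open>A, B, C, D\<close> for its
  coefficients. The first linear equation says \<open>f(-1) = - k\<^sup>2\<close>, so a point \<open>(x, y)\<close> yields
  a factorisation of \<open>y\<^sup>2 + k\<^sup>2 = f(x) - f(-1)\<close> into \<open>x + 1\<close> and a quadratic cofactor. The
  other two equations determine \<open>B\<close> and \<open>C\<close> modulo 4 in terms of \<open>A\<close>, and with this one of
  the two factors is congruent to 3 modulo 4 unless \<open>4 dvd x + 1\<close>, which is impossible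
  because \<open>k\<close> is odd (\<open>no_nonneg_point_on_cubic\<close>). For \<open>x \<ge> 0\<close> both factors are positive, so
  a factor congruent to 3 has a prime divisor \<open>p\<close> congruent to 3 modulo 4
  (\<open>exists_prime_divisor_3_mod_4\<close>). Since \<open>-1\<close> is not a square modulo such a prime,
  \<open>p dvd y\<^sup>2 + k\<^sup>2\<close> forces \<open>p dvd k\<close> (\<open>prime_3_mod_4_dvd_sum_squares\<close>), contrary to the
  hypothesis on the prime divisors of \<open>k\<close>.
\<close>

text \<open>
  A product of primes that are all congruent to 1 modulo 4 is itself congruent to 1. The
  induction strips off one prime divisor: if it is not the required one, its cofactor is
  again congruent to 3.
\<close>

lemma exists_prime_divisor_3_mod_4:
  fixes n :: nat
  assumes "n mod 4 = 3"
  shows "\<exists>p. prime p \<and> p dvd n \<and> p mod 4 = 3"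
  using assms
proof (induction n rule: less_induct)
  case (less n)
  have "n \<noteq> 1" "n > 0" using less.prems by auto
  then obtain p where p: "prime p" "p dvd n"
    using prime_factor_nat by blast
  then obtain m where n: "n = p * m" by blast
  have pm: "(p mod 4) * (m mod 4) mod 4 = 3"
    using less.prems n by (simp add: mod_mult_eq)
  have "p mod 4 \<in> {0, 1, 2, 3}" "m mod 4 \<in> {0, 1, 2, 3}" by auto
  with pm consider "p mod 4 = 3" | "m mod 4 = 3" by auto
  then show ?case
  proof cases
    case 1
    with p show ?thesis by blast
  next
    case 2
    have "m < n"
      using n \<open>n > 0\<close> prime_gt_1_nat[OF p(1)] by simp
    from less.IH[OF this 2] n show ?thesis by (meson dvd_mult)
  qed
qed

text \<open>
  The reason is that \<open>-1\<close> is not a square modulo \<open>p\<close>: if \<open>p\<close> did not divide \<open>k\<close>, it would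
  not divide \<open>y\<close> either, and for \<open>p = 4 m + 3\<close> raising \<open>y\<^sup>2 \<equiv> - k\<^sup>2\<close> to the odd power
  \<open>2 m + 1\<close> would give \<open>y\<^bsup>p - 1\<^esup> \<equiv> - k\<^bsup>p - 1\<^esup>\<close>, against Fermat's little theorem.
\<close>

lemma prime_3_mod_4_dvd_sum_squares:
  fixes p :: nat and y k :: int
  assumes "prime p" and "p mod 4 = 3" and dvd: "int p dvd y\<^sup>2 + k\<^sup>2"
  shows "int p dvd k"
proof (rule ccontr)
  assume k: "\<not> int p dvd k"
  have y: "\<not> int p dvd y"
  proof
    assume "int p dvd y"
    then have "int p dvd y\<^sup>2" by (simp add: power2_eq_square)
    with dvd have "int p dvd k\<^sup>2" by (simp add: dvd_add_right_iff)
    with k \<open>prime p\<close> show False by (simp add: prime_dvd_power_iff)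
  qed
  have fermat: "[z ^ (p - 1) = 1] (mod int p)" if "\<not> int p dvd z" for z
  proof -
    have "coprime z (int p)"
      using prime_imp_coprime[of "int p" z] \<open>prime p\<close> that by (simp add: coprime_commute)
    moreover have "residues (int p)"
      using prime_gt_1_nat[OF \<open>prime p\<close>] by unfold_locales simp
    ultimately have "[z ^ totient (nat (int p)) = 1] (mod int p)"
      by (rule residues.euler_theorem[rotated])
    then show ?thesis using \<open>prime p\<close> by (simp add: totient_prime)
  qed
  define m where "m = p div 4"
  have m: "p - 1 = 2 * (2 * m + 1)"
    using \<open>p mod 4 = 3\<close> unfolding m_def by presburger
  have "[y\<^sup>2 = - (k\<^sup>2)] (mod int p)"
    using dvd by (simp add: cong_iff_dvd_diff)
  then have "[(y\<^sup>2) ^ (2 * m + 1) = (- (k\<^sup>2)) ^ (2 * m + 1)] (mod int p)"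
    by (rule cong_pow)
  then have "[y ^ (p - 1) = - (k ^ (p - 1))] (mod int p)"
    unfolding m power_mult by simp
  moreover have "[- (k ^ (p - 1)) = - 1] (mod int p)"
    using fermat[OF k] by (simp add: cong_minus_minus_iff)
  ultimately have "[1 = - 1] (mod int p)"
    using fermat[OF y] by (metis cong_sym cong_trans)
  then have "int p dvd 2" by (simp add: cong_iff_dvd_diff)
  then have "p \<le> 2" using zdvd_imp_le by fastforce
  with \<open>p mod 4 = 3\<close> show False by (cases "p = 0 \<or> p = 1 \<or> p = 2") auto
qed

lemma sum_squares_no_divisor_3_mod_4:
  fixes k :: nat and y d :: int
  assumes "\<And>p. prime p \<Longrightarrow> p dvd k \<Longrightarrow> [p = 1] (mod 4)"
    and "d > 0" and "d dvd y\<^sup>2 + (int k)\<^sup>2"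
  shows "d mod 4 \<noteq> 3"
proof
  assume "d mod 4 = 3"
  from \<open>d > 0\<close> obtain n where n: "d = int n"
    using zero_less_imp_eq_int by blast
  with \<open>d mod 4 = 3\<close> have "n mod 4 = 3" by presburger
  then obtain p where p: "prime p" "p dvd n" "p mod 4 = 3"
    using exists_prime_divisor_3_mod_4 by blast
  have "int p dvd d" using p(2) n by simp
  then have "int p dvd int k"
    using p prime_3_mod_4_dvd_sum_squares assms(3) dvd_trans by blast
  then have "[p = 1] (mod 4)" using assms(1) p(1) by simp
  with p(3) show False by (simp add: cong_def)
qed

text \<open>
  Modulo 4 the hypotheses say \<open>C \<equiv> - 1 - A\<close> and \<open>B \<equiv> 0\<close>, so the cofactor of \<open>x + 1\<close> is
  congruent to \<open>A x (x - 1) - 1\<close>, hence to 3 unless \<open>x\<close> is 2 or 3 modulo 4. If \<open>x\<close> is 2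
  modulo 4, the factor \<open>x + 1\<close> is itself congruent to 3; if \<open>x\<close> is 3 modulo 4, the product is
  divisible by 4, which a sum of two squares with an odd term is not.
\<close>

lemma no_nonneg_point_on_cubic:
  fixes k :: nat and A B C D u t x y :: int
  assumes "odd k" and primes: "\<And>p. prime p \<Longrightarrow> p dvd k \<Longrightarrow> [p = 1] (mod 4)"
    and e1: "A - B + C - D = (int k)\<^sup>2"
    and e2: "A - B + C = 4 * u - 1"
    and e3: "- 3 * A + C = 4 * t - 1"
    and "x \<ge> 0"
  shows "y\<^sup>2 \<noteq> A * x ^ 3 + B * x\<^sup>2 + C * x + D"
proof
  assume y: "y\<^sup>2 = A * x ^ 3 + B * x\<^sup>2 + C * x + D"
  define g where "g = A * x\<^sup>2 + (B - A) * x + (A - B + C)"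
  have fac: "y\<^sup>2 + (int k)\<^sup>2 = (x + 1) * g"
    unfolding y g_def e1[symmetric] by (simp add: algebra_simps power2_eq_square power3_eq_cube)
  have "y\<^sup>2 + (int k)\<^sup>2 > 0"
    using \<open>odd k\<close> by (intro add_nonneg_pos) (auto intro: Nat.gr0I)
  with fac \<open>x \<ge> 0\<close> have "g > 0" by (simp add: zero_less_mult_iff)
  have g: "g mod 4 \<noteq> 3"
    using sum_squares_no_divisor_3_mod_4[of k g y, OF primes \<open>g > 0\<close>] fac by simp
  have x: "(x + 1) mod 4 \<noteq> 3"
    using sum_squares_no_divisor_3_mod_4[of k "x + 1" y, OF primes] fac \<open>x \<ge> 0\<close> by simp
  have B: "B = 4 * (A + t - u)" using e2 e3 by simp
  have g_eq: "g = A * (x * (x - 1)) - 1 + 4 * ((A + t - u) * x + u)"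
    unfolding g_def e2 unfolding B by (simp add: algebra_simps power2_eq_square)
  have no_4_dvd: "\<not> 4 dvd x * (x - 1)"
  proof
    assume "4 dvd x * (x - 1)"
    then obtain j where "x * (x - 1) = 4 * j" by blast
    with g_eq have "g = 4 * (A * j + (A + t - u) * x + u) - 1" by simp
    then obtain q where "g = 4 * q - 1" by blast
    with g show False by presburger
  qed
  have "x mod 4 = 0 \<or> x mod 4 = 1 \<or> x mod 4 = 2 \<or> x mod 4 = 3" by presburger
  then consider "x mod 4 = 0" | "x mod 4 = 1" | "x mod 4 = 2" | "x mod 4 = 3" by blast
  then show False
  proof cases
    case 1
    then have "4 dvd x" by presburger
    with no_4_dvd show False by simp
  next
    case 2
    then have "4 dvd x - 1" by presburger
    with no_4_dvd show False by simp
  next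
    case 3
    with x show False by presburger
  next
    case 4
    then have "4 dvd x + 1" by presburger
    then have "4 dvd y\<^sup>2 + (int k)\<^sup>2" unfolding fac by simp
    moreover obtain j where j: "int k = 2 * j + 1"
      using \<open>odd k\<close> by (metis even_of_nat oddE)
    have "(int k)\<^sup>2 = 4 * (j\<^sup>2 + j) + 1"
      unfolding j by (simp add: algebra_simps power2_eq_square)
    then obtain q where "(int k)\<^sup>2 = 4 * q + 1" by blast
    ultimately have y3: "y\<^sup>2 mod 4 = 3" by presburger
    show False
    proof (cases "even y")
      case True
      then obtain i where "y = 2 * i" by blast
      then have "y\<^sup>2 = 4 * i\<^sup>2" by (simp add: power2_eq_square)
      with y3 show False by simp
    next
      case False
      then obtain i where "y = 2 * i + 1" by (rule oddE)
      then have "y\<^sup>2 = 4 * (i\<^sup>2 + i) + 1" by (simp add: algebra_simps power2_eq_square)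
      then obtain q where "y\<^sup>2 = 4 * q + 1" by blast
      with y3 show False by simp
    qed
  qed
qed

lemma vector_4_nth:
  "(vector [w, x, y, z] :: 'a::zero^4) $ 1 = w"
  "(vector [w, x, y, z] :: 'a::zero^4) $ 2 = x"
  "(vector [w, x, y, z] :: 'a::zero^4) $ 3 = y"
  "(vector [w, x, y, z] :: 'a::zero^4) $ 4 = z"
  unfolding vector_def by simp_all

lemma coeff_matrix_mult_iff:
  "coeff_matrix a *v c = vector [p, q, r] \<longleftrightarrow>
     a $ 1 $ 1 * c $ 1 - a $ 1 $ 2 * c $ 2 + a $ 1 $ 3 * c $ 3 - a $ 1 $ 4 * c $ 4 = p \<and>
     a $ 2 $ 1 * c $ 1 - a $ 2 $ 2 * c $ 2 + a $ 2 $ 3 * c $ 3 = q \<and>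
     - 3 * (a $ 3 $ 1 * c $ 1) + a $ 3 $ 3 * c $ 3 = r"
  by (simp add: vec_eq_iff forall_3 coeff_matrix_def matrix_vector_mult_def sum_4 vector_4_nth
      algebra_simps)

theorem theorem9:
  fixes k :: nat and u t :: int and a :: "int^4^3" and N :: nat and s :: "nat \<Rightarrow> int^4"
  assumes "k > 0" and "odd k"
    and "\<And>p. prime p \<Longrightarrow> p dvd k \<Longrightarrow> [p = 1] (mod 4)"
    and "a $ 1 $ 1 = a $ 2 $ 1" and "a $ 2 $ 1 = a $ 3 $ 1"
    and "a $ 1 $ 2 = a $ 2 $ 2"
    and "a $ 1 $ 3 = a $ 2 $ 3" and "a $ 2 $ 3 = a $ 3 $ 3"
    and "\<And>i. i \<in> {1..N} \<Longrightarrow>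
           coeff_matrix a *v s i = vector [(int k)\<^sup>2, 4 * u - 1, 4 * t - 1]"
  shows "\<forall>i\<in>{1..N}. \<not> (\<exists>x y :: int. x > 1 \<and> y \<ge> 1 \<and> (x, y) \<in> curve_points a (s i))"
proof (intro ballI notI, elim exE conjE)
  fix i x y
  assume i: "i \<in> {1..N}" and "(1::int) < x" and xy: "(x, y) \<in> curve_points a (s i)"
  note system = assms(9)[OF i, unfolded coeff_matrix_mult_iff]
  have "y\<^sup>2 \<noteq> a $ 1 $ 1 * s i $ 1 * x ^ 3 + a $ 1 $ 2 * s i $ 2 * x\<^sup>2
            + a $ 1 $ 3 * s i $ 3 * x + a $ 1 $ 4 * s i $ 4"
    using system assms(4-8) \<open>1 < x\<close>
    by (intro no_nonneg_point_on_cubic[OF \<open>odd k\<close> assms(3), where u = u and t = t]) auto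
  with xy show False by (simp add: curve_points_def)
qed

end
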